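(* Let $\mathbf{a}=(a_n)_{n\ge 0}$ be a complex sequence such that the sequence $((n+1)a_n)_{n\ge 0}$ is bounded, and let $R_{\mathbf{a}}$ be the associated Rhaly operator acting boundedly on the Hardy space $H^2$. Let $D_{\overline{\mathbf{a}}}$ be the operator on $H^2$ with diagonal matrix $\operatorname{diag}((n+1)\overline{a_n})_{n\ge 0}$ with respect to the standard orthonormal basis $(z^n)_{n\ge 0}$. For $t\ge 0$ let $\varphi_t(z)=e^{-t}z+1-e^{-t}$ ($z\in\mathbb{D}$), and let $C_{\varphi_t}f=f\circ\varphi_t$ be the corresponding composition operator on $H^2$. Then every closed subspace $M$ of $H^2$ which is invariant under $C_{\varphi_t}D_{\overline{\mathbf{a}}}$ for all $t\ge 0$ is invariant under $R_{\mathbf{a}}^*$.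
   Context: $\mathbb{D}$ is the open unit disc and $H^2$ is the Hardy space of holomorphic functions $f(z)=\sum_{k\ge 0}x_kz^k$ on $\mathbb{D}$ with $(x_k)_{k\ge 0}\in\ell^2$, identified isometrically with $\ell^2$ via Taylor coefficients. The Rhaly operator $R_{\mathbf{a}}$ is given, with respect to the basis $(z^n)_{n\ge 0}$, by the lower triangular matrix whose $(n,k)$ entry is $a_n$ for $0\le k\le n$ and $0$ for $k>n$; that is, it maps the coefficient sequence $(x_n)_{n\ge 0}$ to $(a_n\sum_{k=0}^n x_k)_{n\ge 0}$. $R_{\mathbf{a}}^*$ is its Hilbert space adjoint. A subspace $M$ is invariant under $T$ if $TM\subseteq M$. *)

theory Defs
  imports "HOL-Complex_Analysis.Complex_Analysis" "HOL-Library.Function_Algebras"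
begin

section \<open>The Hardy space of the unit disc\<close>

definition taylor_coeff :: "(complex \<Rightarrow> complex) \<Rightarrow> nat \<Rightarrow> complex" where
  "taylor_coeff f n = (deriv ^^ n) f 0 / fact n"

text \<open>
  A function on the disc is represented by a total function that vanishes off the disc, so that
  equality of elements of the space is equality of functions.
\<close>

definition hardy_space :: "(complex \<Rightarrow> complex) set" where
  "hardy_space = {f. f holomorphic_on ball 0 1 \<and> (\<forall>z. z \<notin> ball 0 1 \<longrightarrow> f z = 0) \<and>
     summable (\<lambda>n. (cmod (taylor_coeff f n))\<^sup>2)}"

definition of_coeffs :: "(nat \<Rightarrow> complex) \<Rightarrow> complex \<Rightarrow> complex" where
  "of_coeffs x = (\<lambda>z. if z \<in> ball 0 1 then (\<Sum>n. x n * z ^ n) else 0)"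

definition hardy_inner :: "(complex \<Rightarrow> complex) \<Rightarrow> (complex \<Rightarrow> complex) \<Rightarrow> complex" where
  "hardy_inner f g = (\<Sum>n. taylor_coeff f n * cnj (taylor_coeff g n))"

definition hardy_norm :: "(complex \<Rightarrow> complex) \<Rightarrow> real" where
  "hardy_norm f = sqrt (\<Sum>n. (cmod (taylor_coeff f n))\<^sup>2)"

text \<open>
  The value off the Hardy space is irrelevant; the guard is there because the library's locale of
  metric spaces wants a distance that is symmetric and nonnegative on the whole type.
\<close>

definition hardy_dist :: "(complex \<Rightarrow> complex) \<Rightarrow> (complex \<Rightarrow> complex) \<Rightarrow> real" where
  "hardy_dist f g =
     (if f \<in> hardy_space \<and> g \<in> hardy_space then hardy_norm (f - g) else 0)"

section \<open>Operators\<close>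

text \<open>
  Sensible for operators that are bounded on the Hardy space: existence of the vector is then the
  Riesz representation theorem, and uniqueness is \<open>hardy_adjoint_unique\<close> below.
\<close>

definition hardy_adjoint ::
  "((complex \<Rightarrow> complex) \<Rightarrow> complex \<Rightarrow> complex) \<Rightarrow> (complex \<Rightarrow> complex) \<Rightarrow> complex \<Rightarrow> complex" where
  "hardy_adjoint T g =
     (THE h. h \<in> hardy_space \<and> (\<forall>f\<in>hardy_space. hardy_inner (T f) g = hardy_inner f h))"

definition rhaly_op :: "(nat \<Rightarrow> complex) \<Rightarrow> (complex \<Rightarrow> complex) \<Rightarrow> complex \<Rightarrow> complex" where
  "rhaly_op a f = of_coeffs (\<lambda>n. a n * (\<Sum>k\<le>n. taylor_coeff f k))"

definition diag_op :: "(nat \<Rightarrow> complex) \<Rightarrow> (complex \<Rightarrow> complex) \<Rightarrow> complex \<Rightarrow> complex" where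
  "diag_op d f = of_coeffs (\<lambda>n. d n * taylor_coeff f n)"

definition comp_op :: "(complex \<Rightarrow> complex) \<Rightarrow> (complex \<Rightarrow> complex) \<Rightarrow> complex \<Rightarrow> complex" where
  "comp_op \<phi> f = (\<lambda>z. if z \<in> ball 0 1 then f (\<phi> z) else 0)"

definition phi :: "real \<Rightarrow> complex \<Rightarrow> complex" where
  "phi t z = of_real (exp (- t)) * z + 1 - of_real (exp (- t))"

section \<open>Linear and metric structure\<close>

interpretation cfun: vector_space "\<lambda>(c::complex) (f::complex \<Rightarrow> complex) z. c * f z"
  by unfold_locales (auto simp: fun_eq_iff algebra_simps)

lemma taylor_coeff_sums:
  assumes "f \<in> hardy_space" "z \<in> ball 0 1"
  shows "(\<lambda>n. taylor_coeff f n * z ^ n) sums f z"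
  using holomorphic_power_series[of f 0 1 z] assms
  by (simp add: hardy_space_def taylor_coeff_def)

lemma taylor_coeff_unique:
  assumes "\<And>z. z \<in> ball 0 1 \<Longrightarrow> (\<lambda>n. c n * z ^ n) sums f z"
  shows "taylor_coeff f n = c n"
proof -
  have "summable (\<lambda>n. fps_nth (Abs_fps c) n * (1/2) ^ n)"
    using assms[of "1/2"] by (auto simp: sums_iff)
  hence "fps_conv_radius (Abs_fps c) \<ge> norm (1/2 :: complex)"
    unfolding fps_conv_radius_def by (rule conv_radius_geI)
  hence r: "fps_conv_radius (Abs_fps c) > 0"
    by (rule less_le_trans[rotated]) (simp add: zero_ereal_def)
  have "eventually (\<lambda>z. z \<in> ball 0 1) (nhds (0::complex))"
    by (intro eventually_nhds_in_open) auto
  hence "eventually (\<lambda>z. eval_fps (Abs_fps c) z = f z) (nhds 0)"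
    by eventually_elim (use assms in \<open>auto simp: eval_fps_def sums_iff\<close>)
  with r have "f has_fps_expansion Abs_fps c"
    by (simp add: has_fps_expansion_def)
  hence "(deriv ^^ n) f 0 = (deriv ^^ n) (eval_fps (Abs_fps c)) 0"
    by (intro higher_deriv_cong_ev) (auto simp: has_fps_expansion_def eq_commute)
  thus ?thesis
    using fps_nth_conv_deriv[OF r, of n] by (simp add: taylor_coeff_def)
qed

lemma hardy_space_eqI:
  assumes "f \<in> hardy_space" "g \<in> hardy_space" "\<And>n. taylor_coeff f n = taylor_coeff g n"
  shows "f = g"
proof
  fix z :: complex
  show "f z = g z"
  proof (cases "z \<in> ball 0 1")
    case True
    show ?thesis
      using taylor_coeff_sums[OF assms(1) True] taylor_coeff_sums[OF assms(2) True] assms(3)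
        sums_unique2 by auto
  qed (use assms in \<open>auto simp: hardy_space_def\<close>)
qed

lemma taylor_coeff_diff:
  assumes "f \<in> hardy_space" "g \<in> hardy_space"
  shows "taylor_coeff (f - g) n = taylor_coeff f n - taylor_coeff g n"
  by (rule taylor_coeff_unique)
     (use sums_diff[OF taylor_coeff_sums[OF assms(1)] taylor_coeff_sums[OF assms(2)]]
       in \<open>auto simp: algebra_simps\<close>)

lemma of_coeffs_sums:
  assumes "summable (\<lambda>n. (cmod (x n))\<^sup>2)" "z \<in> ball 0 1"
  shows "(\<lambda>n. x n * z ^ n) sums of_coeffs x z"
proof -
  have z: "norm z < 1" using assms by simp
  have "(norm z)\<^sup>2 < 1" using z by (simp add: power_less_one_iff)
  hence "summable (\<lambda>n. ((norm z)\<^sup>2) ^ n)"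
    by (intro summable_geometric) simp
  with assms(1) have s: "summable (\<lambda>n. (cmod (x n))\<^sup>2 + ((norm z)\<^sup>2) ^ n)"
    by (rule summable_add)
  have "summable (\<lambda>n. x n * z ^ n)"
  proof (rule summable_comparison_test'[OF s, of 0])
    fix n :: nat
    have "2 * (cmod (x n) * norm z ^ n) \<le> (cmod (x n))\<^sup>2 + (norm z ^ n)\<^sup>2"
      using sum_squares_bound[of "cmod (x n)" "norm z ^ n"] by (simp add: mult.assoc)
    moreover have "cmod (x n) * norm z ^ n \<ge> 0" by simp
    ultimately have "cmod (x n) * norm z ^ n \<le> (cmod (x n))\<^sup>2 + (norm z ^ n)\<^sup>2" by linarith
    thus "norm (x n * z ^ n) \<le> (cmod (x n))\<^sup>2 + ((norm z)\<^sup>2) ^ n"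
      by (simp add: norm_mult norm_power power_mult [symmetric] mult.commute)
  qed
  thus ?thesis using assms(2) by (simp add: of_coeffs_def summable_sums)
qed

lemma taylor_coeff_of_coeffs:
  assumes "summable (\<lambda>n. (cmod (x n))\<^sup>2)"
  shows "taylor_coeff (of_coeffs x) n = x n"
  using of_coeffs_sums[OF assms] by (rule taylor_coeff_unique)

lemma of_coeffs_in_hardy_space:
  assumes "summable (\<lambda>n. (cmod (x n))\<^sup>2)"
  shows "of_coeffs x \<in> hardy_space"
proof -
  have "of_coeffs x holomorphic_on ball 0 1"
    by (rule power_series_holomorphic[where a = x]) (use of_coeffs_sums[OF assms] in auto)
  moreover have "of_coeffs x z = 0" if "z \<notin> ball 0 1" for z
    using that by (simp add: of_coeffs_def)
  ultimately show ?thesis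
    using assms by (simp add: hardy_space_def taylor_coeff_of_coeffs)
qed

lemma l2_triangle:
  fixes x y :: "nat \<Rightarrow> complex"
  assumes x: "summable (\<lambda>n. (cmod (x n))\<^sup>2)" and y: "summable (\<lambda>n. (cmod (y n))\<^sup>2)"
  shows "summable (\<lambda>n. (cmod (x n + y n))\<^sup>2)"
    and "sqrt (\<Sum>n. (cmod (x n + y n))\<^sup>2)
           \<le> sqrt (\<Sum>n. (cmod (x n))\<^sup>2) + sqrt (\<Sum>n. (cmod (y n))\<^sup>2)"
proof -
  define B where "B = sqrt (\<Sum>n. (cmod (x n))\<^sup>2) + sqrt (\<Sum>n. (cmod (y n))\<^sup>2)"
  have "B \<ge> 0" unfolding B_def by (intro add_nonneg_nonneg) (auto intro: suminf_nonneg x y)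
  have fin: "(\<Sum>n<N. (cmod (x n + y n))\<^sup>2) \<le> B\<^sup>2" for N
  proof -
    have "sqrt (\<Sum>n<N. (cmod (x n + y n))\<^sup>2) \<le> L2_set (\<lambda>n. cmod (x n) + cmod (y n)) {..<N}"
      unfolding L2_set_def
      by (intro real_sqrt_le_mono sum_mono power_mono norm_triangle_ineq) auto
    also have "\<dots> \<le> L2_set (\<lambda>n. cmod (x n)) {..<N} + L2_set (\<lambda>n. cmod (y n)) {..<N}"
      by (rule L2_set_triangle_ineq)
    also have "\<dots> \<le> B"
      unfolding L2_set_def B_def
      by (intro add_mono real_sqrt_le_mono sum_le_suminf x y) auto
    finally have "sqrt (\<Sum>n<N. (cmod (x n + y n))\<^sup>2) \<le> B" .
    thus ?thesis using \<open>B \<ge> 0\<close> sqrt_le_D by blast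
  qed
  show s: "summable (\<lambda>n. (cmod (x n + y n))\<^sup>2)"
    by (rule summableI_nonneg_bounded[OF _ fin]) auto
  have "(\<Sum>n. (cmod (x n + y n))\<^sup>2) \<le> B\<^sup>2"
    by (rule suminf_le_const[OF s fin])
  thus "sqrt (\<Sum>n. (cmod (x n + y n))\<^sup>2)
           \<le> sqrt (\<Sum>n. (cmod (x n))\<^sup>2) + sqrt (\<Sum>n. (cmod (y n))\<^sup>2)"
    using \<open>B \<ge> 0\<close> by (simp add: B_def [symmetric] real_le_lsqrt)
qed

lemma hardy_space_diff:
  assumes "f \<in> hardy_space" "g \<in> hardy_space"
  shows "f - g \<in> hardy_space"
proof -
  have "summable (\<lambda>n. (cmod (taylor_coeff f n + - taylor_coeff g n))\<^sup>2)"
    by (rule l2_triangle) (use assms in \<open>auto simp: hardy_space_def\<close>)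
  moreover have "(\<lambda>z. f z - g z) holomorphic_on ball 0 1"
    using assms by (intro holomorphic_intros) (auto simp: hardy_space_def)
  ultimately show ?thesis
    using assms taylor_coeff_diff[OF assms]
    by (auto simp: hardy_space_def fun_diff_def)
qed

interpretation hardy: Metric_space hardy_space hardy_dist
proof
  have zero_eq: "hardy_norm (f - g) = 0 \<longleftrightarrow> f = g" if fg: "f \<in> hardy_space" "g \<in> hardy_space" for f g
  proof -
    have "summable (\<lambda>n. (cmod (taylor_coeff (f - g) n))\<^sup>2)"
      using hardy_space_diff[OF fg] by (simp add: hardy_space_def)
    hence "hardy_norm (f - g) = 0 \<longleftrightarrow> (\<forall>n. taylor_coeff (f - g) n = 0)"
      by (simp add: hardy_norm_def suminf_eq_zero_iff)
    also have "\<dots> \<longleftrightarrow> f = g"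
      using hardy_space_eqI[OF fg] by (auto simp: taylor_coeff_diff[OF fg])
    finally show ?thesis .
  qed
  fix f g h
  have "summable (\<lambda>n. (cmod (taylor_coeff (f - g) n))\<^sup>2)"
    if "f \<in> hardy_space" "g \<in> hardy_space"
    using hardy_space_diff[OF that] by (simp add: hardy_space_def)
  thus "0 \<le> hardy_dist f g"
    by (auto simp: hardy_dist_def hardy_norm_def intro!: suminf_nonneg)
  show "hardy_dist f g = hardy_dist g f"
    by (auto simp: hardy_dist_def hardy_norm_def taylor_coeff_diff norm_minus_commute)
  assume fg: "f \<in> hardy_space" "g \<in> hardy_space"
  show "hardy_dist f g = 0 \<longleftrightarrow> f = g"
    using zero_eq[OF fg] fg by (simp add: hardy_dist_def)
  assume h: "h \<in> hardy_space"
  show "hardy_dist f h \<le> hardy_dist f g + hardy_dist g h"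
  proof -
    have "summable (\<lambda>n. (cmod (taylor_coeff (f - g) n))\<^sup>2)"
      "summable (\<lambda>n. (cmod (taylor_coeff (g - h) n))\<^sup>2)"
      using hardy_space_diff[OF fg] hardy_space_diff[OF fg(2) h] by (simp_all add: hardy_space_def)
    from l2_triangle(2)[OF this] show ?thesis
      using fg h by (simp add: hardy_dist_def hardy_norm_def taylor_coeff_diff)
  qed
qed

lemma hardy_adjoint_unique:
  assumes "h1 \<in> hardy_space" "h2 \<in> hardy_space"
    and "\<And>f. f \<in> hardy_space \<Longrightarrow> hardy_inner f h1 = hardy_inner f h2"
  shows "h1 = h2"
proof (rule hardy_space_eqI[OF assms(1,2)])
  fix n
  define e :: "nat \<Rightarrow> complex" where "e = (\<lambda>k. if k = n then 1 else 0)"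
  have s: "summable (\<lambda>k. (cmod (e k))\<^sup>2)"
    by (rule summable_finite[of "{n}"]) (auto simp: e_def)
  have *: "hardy_inner (of_coeffs e) h = cnj (taylor_coeff h n)" for h
  proof -
    have "(\<Sum>k. e k * cnj (taylor_coeff h k)) = (\<Sum>k\<in>{n}. e k * cnj (taylor_coeff h k))"
      by (rule suminf_finite) (auto simp: e_def)
    thus ?thesis
      by (simp add: hardy_inner_def taylor_coeff_of_coeffs[OF s]) (simp add: e_def)
  qed
  have "cnj (taylor_coeff h1 n) = cnj (taylor_coeff h2 n)"
    using assms(3)[OF of_coeffs_in_hardy_space[OF s]] by (simp only: *)
  thus "taylor_coeff h1 n = taylor_coeff h2 n" by simp
qed

end

theory Submission
  imports Defs
begin

text \<open>
  On Taylor coefficients, \<open>R_a\<^sup>* = A D\<close> where \<open>A\<close> is the adjoint of the Cesaro operator, and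
  \<open>A = \<integral>\<^sub>0\<^sup>\<infinity> e\<^bsup>-t\<^esup> C\<^bsub>\<phi>_t\<^esub> dt\<close>. Substituting \<open>s = e\<^bsup>-t\<^esup>\<close>, the matrix of the composition operator has the
  Bernstein polynomials \<open>B\<^bsub>n,k\<^esub>(s)\<close> as entries, and \<open>\<integral>\<^sub>0\<^sup>1 B\<^bsub>n,k\<^esub>(s) ds = 1/(n+1)\<close>. The Schur test gives
  the operator norm bound \<open>s\<^bsup>-1/2\<^esup>\<close>, so the Riemann sums of the integral over \<open>s\<close> are bounded by 2
  uniformly; as their entries converge and they are upper triangular, they converge strongly
  to \<open>A\<close>. Applied to \<open>D f\<close> with \<open>f\<close> in \<open>M\<close>, every Riemann sum lies in \<open>M\<close>, hence so does the limit.
\<close>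

section \<open>Square-summable sequences\<close>

definition ell2 :: "(nat \<Rightarrow> complex) set" where
  "ell2 = {x. summable (\<lambda>n. (cmod (x n))\<^sup>2)}"

definition ell2_norm :: "(nat \<Rightarrow> complex) \<Rightarrow> real" where
  "ell2_norm x = sqrt (\<Sum>n. (cmod (x n))\<^sup>2)"

lemma ell2_norm_nonneg [simp]: "x \<in> ell2 \<Longrightarrow> 0 \<le> ell2_norm x"
  by (simp add: ell2_norm_def ell2_def suminf_nonneg)

lemma L2_set_le_ell2_norm:
  assumes "x \<in> ell2"
  shows "L2_set (\<lambda>n. cmod (x n)) {..<N} \<le> ell2_norm x"
  using assms unfolding L2_set_def ell2_norm_def ell2_def
  by (auto intro!: sum_le_suminf)

text \<open>The terms being nonnegative, a uniform bound on the partial sums gives convergence and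
  passes to the limit. This lets later norm estimates be proved on finite sections.\<close>

lemma ell2_boundedI:
  assumes "\<And>N. L2_set (\<lambda>n. cmod (x n)) {..<N} \<le> B"
  shows "x \<in> ell2" and "ell2_norm x \<le> B"
proof -
  have "0 \<le> B"
    using order_trans[OF L2_set_nonneg assms] .
  have fin: "(\<Sum>n<N. (cmod (x n))\<^sup>2) \<le> B\<^sup>2" for N
    using assms[of N] sqrt_le_D unfolding L2_set_def by blast
  show *: "x \<in> ell2"
    unfolding ell2_def by (auto intro: summableI_nonneg_bounded[OF _ fin])
  have "(\<Sum>n. (cmod (x n))\<^sup>2) \<le> B\<^sup>2"
    by (rule suminf_le_const[OF _ fin]) (use * in \<open>simp add: ell2_def\<close>)
  thus "ell2_norm x \<le> B"
    using \<open>0 \<le> B\<close> by (simp add: ell2_norm_def real_le_lsqrt)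
qed

lemma ell2_diff: "x \<in> ell2 \<Longrightarrow> y \<in> ell2 \<Longrightarrow> (\<lambda>n. x n - y n) \<in> ell2"
  using l2_triangle(1)[of x "\<lambda>n. - y n"] by (simp add: ell2_def)

lemma ell2_norm_triangle:
  "x \<in> ell2 \<Longrightarrow> y \<in> ell2 \<Longrightarrow> ell2_norm (\<lambda>n. x n + y n) \<le> ell2_norm x + ell2_norm y"
  using l2_triangle(2) by (simp add: ell2_def ell2_norm_def)

lemma ell2_bounded_mult:
  assumes "x \<in> ell2" and "\<And>n. cmod (d n) \<le> B"
  shows "(\<lambda>n. d n * x n) \<in> ell2"
proof -
  have "summable (\<lambda>n. B\<^sup>2 * (cmod (x n))\<^sup>2)"
    using assms(1) by (intro summable_mult) (simp add: ell2_def)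
  hence "summable (\<lambda>n. (cmod (d n * x n))\<^sup>2)"
  proof (rule summable_comparison_test'[of _ 0])
    fix n
    show "norm ((cmod (d n * x n))\<^sup>2) \<le> B\<^sup>2 * (cmod (x n))\<^sup>2"
      using assms(2)[of n] by (simp add: norm_mult power_mult_distrib mult_right_mono power_mono)
  qed
  thus ?thesis by (simp add: ell2_def)
qed

lemma ell2_cnj [simp]: "(\<lambda>n. cnj (x n)) \<in> ell2 \<longleftrightarrow> x \<in> ell2"
  by (simp add: ell2_def)

lemma ell2_powers: "cmod z < 1 \<Longrightarrow> (\<lambda>n. z ^ n) \<in> ell2"
proof -
  assume "cmod z < 1"
  hence "summable (\<lambda>n. ((cmod z)\<^sup>2) ^ n)"
    by (intro summable_geometric) (simp add: power_less_one_iff)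
  thus ?thesis
    by (simp add: ell2_def norm_power power_mult [symmetric] mult.commute)
qed

lemma ell2_Cauchy_Schwarz:
  assumes "x \<in> ell2" "y \<in> ell2"
  shows "summable (\<lambda>n. x n * y n)" and "cmod (\<Sum>n. x n * y n) \<le> ell2_norm x * ell2_norm y"
proof -
  have fin: "(\<Sum>n<N. cmod (x n * y n)) \<le> ell2_norm x * ell2_norm y" for N
  proof -
    have "(\<Sum>n<N. cmod (x n * y n))
        \<le> L2_set (\<lambda>n. cmod (x n)) {..<N} * L2_set (\<lambda>n. cmod (y n)) {..<N}"
      using L2_set_mult_ineq[of "\<lambda>n. cmod (x n)" "\<lambda>n. cmod (y n)" "{..<N}"]
      by (simp add: norm_mult)
    also have "\<dots> \<le> ell2_norm x * ell2_norm y"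
      by (intro mult_mono L2_set_le_ell2_norm assms ell2_norm_nonneg L2_set_nonneg)
    finally show ?thesis .
  qed
  have s: "summable (\<lambda>n. cmod (x n * y n))"
    by (rule summableI_nonneg_bounded[OF _ fin]) auto
  thus "summable (\<lambda>n. x n * y n)"
    by (rule summable_norm_cancel)
  have "cmod (\<Sum>n. x n * y n) \<le> (\<Sum>n. cmod (x n * y n))"
    by (rule summable_norm[OF s])
  also have "\<dots> \<le> ell2_norm x * ell2_norm y"
    by (rule suminf_le_const[OF s fin])
  finally show "cmod (\<Sum>n. x n * y n) \<le> ell2_norm x * ell2_norm y" .
qed

definition truncate :: "nat \<Rightarrow> (nat \<Rightarrow> complex) \<Rightarrow> nat \<Rightarrow> complex" where
  "truncate N x = (\<lambda>n. if n < N then x n else 0)"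

lemma truncate_ell2: "truncate N x \<in> ell2"
  unfolding ell2_def mem_Collect_eq
  by (rule summable_finite[of "{..<N}"]) (auto simp: truncate_def)

lemma truncate_tendsto:
  assumes "x \<in> ell2"
  shows "(\<lambda>N. ell2_norm (\<lambda>n. x n - truncate N x n)) \<longlonglongrightarrow> 0"
proof -
  let ?f = "\<lambda>n. (cmod (x n))\<^sup>2"
  have s: "summable ?f" using assms by (simp add: ell2_def)
  have "(\<Sum>n. (cmod (x n - truncate N x n))\<^sup>2) = (\<Sum>n. ?f (n + N))" for N
  proof -
    have "summable (\<lambda>n. (cmod (x n - truncate N x n))\<^sup>2)"
      using ell2_diff[OF assms truncate_ell2] by (simp add: ell2_def)
    from suminf_split_initial_segment[OF this, of N] show ?thesis
      by (simp add: truncate_def)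
  qed
  moreover have "(\<lambda>N. \<Sum>n. ?f (n + N)) \<longlonglongrightarrow> 0"
    using suminf_exist_split2[OF s] .
  ultimately show ?thesis
    unfolding ell2_norm_def using tendsto_real_sqrt by fastforce
qed

section \<open>Real matrices acting boundedly on sequences\<close>

definition kernel_op :: "(nat \<Rightarrow> nat \<Rightarrow> real) \<Rightarrow> (nat \<Rightarrow> complex) \<Rightarrow> nat \<Rightarrow> complex" where
  "kernel_op K x k = (\<Sum>n. K k n *\<^sub>R x n)"

text \<open>Boundedness is phrased through the finite sections of the matrix, uniformly in their
  size. No series has to converge beforehand, and sums, multiples and transposes are treated by
  finite algebra.\<close>

definition kernel_bound :: "(nat \<Rightarrow> nat \<Rightarrow> real) \<Rightarrow> real \<Rightarrow> bool" where
  "kernel_bound K C \<longleftrightarrow> 0 \<le> C \<and> (\<forall>x m L.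
     L2_set (\<lambda>k. cmod (\<Sum>n<L. K k n *\<^sub>R x n)) {..<m} \<le> C * L2_set (\<lambda>n. cmod (x n)) {..<L})"

lemma kernel_boundD:
  "kernel_bound K C \<Longrightarrow>
     L2_set (\<lambda>k. cmod (\<Sum>n<L. K k n *\<^sub>R x n)) {..<m} \<le> C * L2_set (\<lambda>n. cmod (x n)) {..<L}"
  by (simp add: kernel_bound_def)

lemma kernel_bound_mono: "kernel_bound K C \<Longrightarrow> C \<le> C' \<Longrightarrow> kernel_bound K C'"
  unfolding kernel_bound_def
  by (meson L2_set_nonneg mult_right_mono order_trans)

lemma kernel_bound_scale:
  assumes "kernel_bound K C"
  shows "kernel_bound (\<lambda>k n. c * K k n) (\<bar>c\<bar> * C)"
proof -
  have "L2_set (\<lambda>k. cmod (\<Sum>n<L. (c * K k n) *\<^sub>R x n)) {..<m}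
      = \<bar>c\<bar> * L2_set (\<lambda>k. cmod (\<Sum>n<L. K k n *\<^sub>R x n)) {..<m}" for x m L
    by (simp add: scaleR_right.sum [symmetric] scaleR_scaleR [symmetric] L2_set_right_distrib
        del: scaleR_scaleR)
  thus ?thesis
    using assms by (auto simp: kernel_bound_def mult.assoc intro: mult_left_mono)
qed

lemma kernel_bound_add:
  assumes "kernel_bound K C" "kernel_bound K' C'"
  shows "kernel_bound (\<lambda>k n. K k n + K' k n) (C + C')"
proof -
  have "L2_set (\<lambda>k. cmod (\<Sum>n<L. (K k n + K' k n) *\<^sub>R x n)) {..<m}
      \<le> (C + C') * L2_set (\<lambda>n. cmod (x n)) {..<L}" for x m L
  proof -
    have "L2_set (\<lambda>k. cmod (\<Sum>n<L. (K k n + K' k n) *\<^sub>R x n)) {..<m}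
        \<le> L2_set (\<lambda>k. cmod (\<Sum>n<L. K k n *\<^sub>R x n) + cmod (\<Sum>n<L. K' k n *\<^sub>R x n)) {..<m}"
      by (rule L2_set_mono) (auto simp: scaleR_left_distrib sum.distrib norm_triangle_ineq)
    also have "\<dots> \<le> L2_set (\<lambda>k. cmod (\<Sum>n<L. K k n *\<^sub>R x n)) {..<m}
        + L2_set (\<lambda>k. cmod (\<Sum>n<L. K' k n *\<^sub>R x n)) {..<m}"
      by (rule L2_set_triangle_ineq)
    also have "\<dots> \<le> (C + C') * L2_set (\<lambda>n. cmod (x n)) {..<L}"
      using kernel_boundD[OF assms(1)] kernel_boundD[OF assms(2)]
      by (simp add: distrib_right add_mono)
    finally show ?thesis .
  qed
  thus ?thesis
    using assms by (simp add: kernel_bound_def)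
qed

lemma kernel_bound_sum:
  assumes "finite J" "\<And>j. j \<in> J \<Longrightarrow> kernel_bound (K j) (C j)"
  shows "kernel_bound (\<lambda>k n. \<Sum>j\<in>J. K j k n) (\<Sum>j\<in>J. C j)"
  using assms
proof (induction J rule: finite_induct)
  case empty
  show ?case by (simp add: kernel_bound_def L2_set_def)
next
  case (insert j J)
  thus ?case using kernel_bound_add[of "K j" "C j"] by simp
qed

text \<open>Cancels one factor when a norm is bounded in terms of itself, as in the duality argument
  and in Hardy's inequality. The assumption \<open>0 \<le> c\<close> covers
  \<open>y = 0\<close>.\<close>

lemma le_of_mult_self_le:
  fixes y c :: real
  assumes "y * y \<le> c * y" "0 \<le> y" "0 \<le> c"
  shows "y \<le> c"
  using assms by (cases "y = 0") (auto simp: mult_le_cancel_right)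

text \<open>Duality: if \<open>y\<close> is the transpose applied to \<open>u\<close>, then the
  squared norm of \<open>y\<close> is the pairing of \<open>u\<close> with \<open>K\<close> applied
  to \<open>cnj y\<close>. Cauchy-Schwarz and the bound for \<open>K\<close> give at most C times
  the norms of \<open>u\<close> and \<open>y\<close>, and one norm of \<open>y\<close>
  cancels.\<close>

lemma kernel_bound_transpose:
  assumes "kernel_bound K C"
  shows "kernel_bound (\<lambda>n k. K k n) C"
proof -
  have "L2_set (\<lambda>n. cmod (\<Sum>k<m. K k n *\<^sub>R u k)) {..<L}
      \<le> C * L2_set (\<lambda>k. cmod (u k)) {..<m}" for u m L
  proof -
    define y where "y = (\<lambda>n. \<Sum>k<m. K k n *\<^sub>R u k)"
    let ?Y = "L2_set (\<lambda>n. cmod (y n)) {..<L}" and ?U = "L2_set (\<lambda>k. cmod (u k)) {..<m}"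
    have "complex_of_real (\<Sum>n<L. (cmod (y n))\<^sup>2) = (\<Sum>n<L. y n * cnj (y n))"
      unfolding of_real_sum by (intro sum.cong complex_norm_square refl)
    also have "\<dots> = (\<Sum>n<L. \<Sum>k<m. u k * K k n *\<^sub>R cnj (y n))"
      by (subst (1) y_def) (simp add: sum_distrib_right)
    also have "\<dots> = (\<Sum>k<m. u k * (\<Sum>n<L. K k n *\<^sub>R cnj (y n)))"
      by (subst sum.swap) (simp add: sum_distrib_left)
    finally have "cmod (complex_of_real (\<Sum>n<L. (cmod (y n))\<^sup>2))
        = cmod (\<Sum>k<m. u k * (\<Sum>n<L. K k n *\<^sub>R cnj (y n)))"
      by (rule arg_cong)
    hence "?Y\<^sup>2 = cmod (\<Sum>k<m. u k * (\<Sum>n<L. K k n *\<^sub>R cnj (y n)))"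
      unfolding norm_of_real by (simp add: L2_set_def sum_nonneg)
    also have "\<dots> \<le> (\<Sum>k<m. cmod (u k) * cmod (\<Sum>n<L. K k n *\<^sub>R cnj (y n)))"
      by (rule sum_norm_le) (simp add: norm_mult)
    also have "\<dots> \<le> ?U * L2_set (\<lambda>k. cmod (\<Sum>n<L. K k n *\<^sub>R cnj (y n))) {..<m}"
      using L2_set_mult_ineq[of "\<lambda>k. cmod (u k)" "\<lambda>k. cmod (\<Sum>n<L. K k n *\<^sub>R cnj (y n))" "{..<m}"]
      by simp
    also have "\<dots> \<le> ?U * (C * ?Y)"
      using kernel_boundD[OF assms, where x = "\<lambda>n. cnj (y n)"]
      by (intro mult_left_mono) auto
    finally have "?Y * ?Y \<le> (C * ?U) * ?Y"
      by (simp add: power2_eq_square mult_ac)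
    moreover have "0 \<le> C * ?U"
      using assms by (simp add: kernel_bound_def)
    ultimately have "?Y \<le> C * ?U"
      by (rule le_of_mult_self_le[OF _ L2_set_nonneg])
    thus ?thesis by (simp add: y_def)
  qed
  thus ?thesis using assms by (simp add: kernel_bound_def)
qed

lemma kernel_bound_column_ell2:
  assumes "kernel_bound K C"
  shows "(\<lambda>k. of_real (K k n)) \<in> ell2"
proof (rule ell2_boundedI)
  fix m
  \<comment> \<open>Column \<open>n\<close> is the image of the n-th unit vector; the section must
    have length \<open>Suc n\<close> to contain index \<open>n\<close>.\<close>
  have "(\<Sum>i<Suc n. K k i *\<^sub>R (if i = n then 1 else 0)) = complex_of_real (K k n)" for k
    by (simp add: scaleR_conv_of_real if_distrib cong: if_cong)
  thus "L2_set (\<lambda>k. cmod (of_real (K k n))) {..<m}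
      \<le> C * L2_set (\<lambda>i. cmod (if i = n then 1 else 0)) {..<Suc n}"
    using kernel_boundD[OF assms, where L = "Suc n" and x = "\<lambda>i. if i = n then 1 else 0"]
    by simp
qed

text \<open>A row of \<open>K\<close> is a column of its transpose, hence square-summable, and
  Cauchy-Schwarz applies.\<close>

lemma kernel_op_summable:
  assumes "kernel_bound K C" "x \<in> ell2"
  shows "summable (\<lambda>n. K k n *\<^sub>R x n)"
  using ell2_Cauchy_Schwarz(1)[OF kernel_bound_column_ell2[OF kernel_bound_transpose] assms(2)]
    assms(1) by (simp add: scaleR_conv_of_real)

lemma
  assumes "kernel_bound K C" "x \<in> ell2"
  shows kernel_op_ell2: "kernel_op K x \<in> ell2"
    and kernel_op_norm_le: "ell2_norm (kernel_op K x) \<le> C * ell2_norm x"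
proof -
  \<comment> \<open>For fixed \<open>m\<close> only finitely many coordinates occur, so the section
    bound survives the limit in \<open>L\<close>; afterwards \<open>m\<close> is free.\<close>
  have "L2_set (\<lambda>k. cmod (kernel_op K x k)) {..<m} \<le> C * ell2_norm x" for m
  proof (rule LIMSEQ_le_const2)
    have "(\<lambda>L. \<Sum>n<L. K k n *\<^sub>R x n) \<longlonglongrightarrow> kernel_op K x k" for k
      unfolding kernel_op_def by (rule summable_LIMSEQ[OF kernel_op_summable[OF assms]])
    thus "(\<lambda>L. L2_set (\<lambda>k. cmod (\<Sum>n<L. K k n *\<^sub>R x n)) {..<m})
        \<longlonglongrightarrow> L2_set (\<lambda>k. cmod (kernel_op K x k)) {..<m}"
      unfolding L2_set_def by (intro tendsto_intros)
    have "L2_set (\<lambda>k. cmod (\<Sum>n<L. K k n *\<^sub>R x n)) {..<m} \<le> C * ell2_norm x" for L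
      by (rule order_trans[OF kernel_boundD[OF assms(1)] mult_left_mono])
         (use assms in \<open>auto simp: kernel_bound_def L2_set_le_ell2_norm\<close>)
    thus "\<exists>N. \<forall>L\<ge>N. L2_set (\<lambda>k. cmod (\<Sum>n<L. K k n *\<^sub>R x n)) {..<m} \<le> C * ell2_norm x"
      by blast
  qed
  from ell2_boundedI[OF this]
  show "kernel_op K x \<in> ell2" "ell2_norm (kernel_op K x) \<le> C * ell2_norm x" by auto
qed

lemma kernel_op_add:
  assumes "kernel_bound K C" "x \<in> ell2" "y \<in> ell2"
  shows "kernel_op K (\<lambda>n. x n + y n) k = kernel_op K x k + kernel_op K y k"
  unfolding kernel_op_def
  using suminf_add[OF kernel_op_summable[OF assms(1,2)] kernel_op_summable[OF assms(1,3)]]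
  by (simp add: scaleR_right_distrib)

lemma kernel_op_truncate: "kernel_op K (truncate N x) k = (\<Sum>n<N. K k n *\<^sub>R x n)"
  unfolding kernel_op_def
  by (subst suminf_finite[of "{..<N}"]) (auto simp: truncate_def)

lemma kernel_op_split:
  assumes "kernel_bound K C" "x \<in> ell2"
  shows "kernel_op K x k
    = kernel_op K (truncate N x) k + kernel_op K (\<lambda>n. x n - truncate N x n) k"
  using kernel_op_add[OF assms(1) truncate_ell2[of N x] ell2_diff[OF assms(2) truncate_ell2[of N x]]]
  by simp

text \<open>A bilinear duality, without conjugation. The double series need not converge absolutely,
  so only finitely many \<open>n\<close> are exchanged with the sum over \<open>k\<close>; the rest
  is the pairing of \<open>u\<close> with the image of a tail of \<open>x\<close>, which
  Cauchy-Schwarz and the bound for \<open>K\<close> send to 0.\<close>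

lemma kernel_op_pairing:
  assumes K: "kernel_bound K C" and u: "u \<in> ell2" and x: "x \<in> ell2"
  shows "(\<lambda>n. kernel_op (\<lambda>n k. K k n) u n * x n) sums (\<Sum>k. u k * kernel_op K x k)"
proof -
  let ?r = "\<lambda>N n. x n - truncate N x n"
  note KT = kernel_bound_transpose[OF K]
  have partial: "(\<Sum>n<N. kernel_op (\<lambda>n k. K k n) u n * x n)
      = (\<Sum>k. u k * kernel_op K x k) - (\<Sum>k. u k * kernel_op K (?r N) k)" for N
  proof -
    have s: "summable (\<lambda>k. K k n *\<^sub>R u k * x n)" for n
      by (intro summable_mult2 kernel_op_summable[OF KT u])
    have "(\<Sum>n<N. kernel_op (\<lambda>n k. K k n) u n * x n) = (\<Sum>n<N. \<Sum>k. K k n *\<^sub>R u k * x n)"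
      by (simp add: kernel_op_def suminf_mult2[OF kernel_op_summable[OF KT u]])
    also have "\<dots> = (\<Sum>k. \<Sum>n<N. K k n *\<^sub>R u k * x n)"
      by (rule suminf_sum[symmetric]) (rule s)
    also have "\<dots> = (\<Sum>k. u k * kernel_op K (truncate N x) k)"
      by (simp add: kernel_op_truncate sum_distrib_left mult_ac)
    also have "\<dots> = (\<Sum>k. u k * kernel_op K x k - u k * kernel_op K (?r N) k)"
      by (subst kernel_op_split[OF K x, of _ N]) (simp add: algebra_simps)
    also have "\<dots> = (\<Sum>k. u k * kernel_op K x k) - (\<Sum>k. u k * kernel_op K (?r N) k)"
      by (intro suminf_diff[symmetric] ell2_Cauchy_Schwarz(1) u kernel_op_ell2[OF K] x ell2_diff
          truncate_ell2)
    finally show ?thesis .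
  qed
  have "(\<lambda>N. \<Sum>k. u k * kernel_op K (?r N) k) \<longlonglongrightarrow> 0"
  proof (rule Lim_null_comparison)
    have "cmod (\<Sum>k. u k * kernel_op K (?r N) k) \<le> ell2_norm u * (C * ell2_norm (?r N))" for N
    proof -
      have r: "?r N \<in> ell2" by (intro ell2_diff x truncate_ell2)
      show ?thesis
        by (rule order_trans[OF ell2_Cauchy_Schwarz(2)[OF u kernel_op_ell2[OF K r]]])
           (intro mult_left_mono kernel_op_norm_le[OF K r] ell2_norm_nonneg u)
    qed
    thus "\<forall>\<^sub>F N in sequentially. norm (\<Sum>k. u k * kernel_op K (?r N) k)
        \<le> ell2_norm u * (C * ell2_norm (?r N))" by simp
    show "(\<lambda>N. ell2_norm u * (C * ell2_norm (?r N))) \<longlonglongrightarrow> 0"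
      by (intro tendsto_mult_right_zero truncate_tendsto x)
  qed
  hence "(\<lambda>N. (\<Sum>k. u k * kernel_op K x k) - (\<Sum>k. u k * kernel_op K (?r N) k))
      \<longlonglongrightarrow> (\<Sum>k. u k * kernel_op K x k) - 0"
    by (intro tendsto_diff tendsto_const)
  thus ?thesis
    by (simp add: sums_def partial)
qed

text \<open>Split \<open>x\<close> at an index L. The tail is small uniformly in \<open>N\<close> by
  the common bound \<open>C\<close>; on the head, triangularity leaves an L by L block, where
  convergence of the entries is enough.\<close>

lemma kernel_op_tendsto_zero:
  assumes K: "\<And>N. kernel_bound (K N) C"
    and triangular: "\<And>N k n. n < k \<Longrightarrow> K N k n = 0"
    and entries: "\<And>k n. (\<lambda>N. K N k n) \<longlonglongrightarrow> 0"
    and x: "x \<in> ell2"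
  shows "(\<lambda>N. ell2_norm (kernel_op (K N) x)) \<longlonglongrightarrow> 0"
proof (rule LIMSEQ_I)
  fix e :: real assume "0 < e"
  let ?r = "\<lambda>L n. x n - truncate L x n"
  have r: "?r L \<in> ell2" for L by (intro ell2_diff x truncate_ell2)
  have "(\<lambda>L. C * ell2_norm (?r L)) \<longlonglongrightarrow> 0"
    by (intro tendsto_mult_right_zero truncate_tendsto x)
  hence "\<forall>\<^sub>F L in sequentially. C * ell2_norm (?r L) < e / 2"
    using \<open>0 < e\<close> by (intro order_tendstoD(2)) auto
  then obtain L where L: "C * ell2_norm (?r L) < e / 2"
    using eventually_happens'[OF sequentially_bot] by blast
  \<comment> \<open>Rows with index at least \<open>L\<close> vanish on vectors supported below
    \<open>L\<close>, so this norm is a finite sum and the limit can be taken entry by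
    entry.\<close>
  have norm_head: "ell2_norm (kernel_op (K N) (truncate L x))
      = sqrt (\<Sum>k<L. (cmod (\<Sum>n<L. K N k n *\<^sub>R x n))\<^sup>2)" for N
    unfolding ell2_norm_def kernel_op_truncate
    by (subst suminf_finite[of "{..<L}"]) (auto simp: triangular intro!: sum.neutral)
  have "(\<lambda>N. sqrt (\<Sum>k<L. (cmod (\<Sum>n<L. K N k n *\<^sub>R x n))\<^sup>2))
      \<longlonglongrightarrow> sqrt (\<Sum>k<L. (cmod (\<Sum>n<L. 0 *\<^sub>R x n))\<^sup>2)"
    by (intro tendsto_intros entries)
  hence "(\<lambda>N. ell2_norm (kernel_op (K N) (truncate L x))) \<longlonglongrightarrow> 0"
    by (simp add: norm_head)
  hence "\<forall>\<^sub>F N in sequentially. ell2_norm (kernel_op (K N) (truncate L x)) < e / 2"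
    using \<open>0 < e\<close> by (intro order_tendstoD(2)) auto
  then obtain N0
    where N0: "\<And>N. N \<ge> N0 \<Longrightarrow> ell2_norm (kernel_op (K N) (truncate L x)) < e / 2"
    unfolding eventually_sequentially by blast
  have "norm (ell2_norm (kernel_op (K N) x) - 0) < e" if "N \<ge> N0" for N
  proof -
    have "kernel_op (K N) x = (\<lambda>k. kernel_op (K N) (truncate L x) k + kernel_op (K N) (?r L) k)"
      using kernel_op_split[OF K x] by (intro ext)
    hence "ell2_norm (kernel_op (K N) x)
        \<le> ell2_norm (kernel_op (K N) (truncate L x)) + ell2_norm (kernel_op (K N) (?r L))"
      by (simp only:) (intro ell2_norm_triangle kernel_op_ell2[OF K] r truncate_ell2)
    also have "\<dots> < e"
      using N0[OF that] kernel_op_norm_le[OF K r, of N L] L by linarith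
    finally show ?thesis
      using ell2_norm_nonneg[OF kernel_op_ell2[OF K x]] by simp
  qed
  thus "\<exists>N0. \<forall>N\<ge>N0. norm (ell2_norm (kernel_op (K N) x) - 0) < e" by blast
qed

section \<open>Hardy's inequality for the adjoint of the Cesaro operator\<close>

definition cesaro_adjoint :: "nat \<Rightarrow> nat \<Rightarrow> real" where
  "cesaro_adjoint k n = (if k \<le> n then 1 / (real n + 1) else 0)"

text \<open>
  With \<open>b = A v\<close> one has \<open>v\<^sub>k = (k + 1) (b\<^sub>k - b\<^bsub>k+1\<^esub>)\<close>, which makes \<open>\<Sum>\<^sub>k b\<^sub>k\<^sup>2 - 2 b\<^sub>k v\<^sub>k\<close> at most a
  telescoping sum with value 0 (Elliott's proof of Hardy's inequality).
\<close>

lemma kernel_bound_cesaro_adjoint: "kernel_bound cesaro_adjoint 2"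
proof -
  have "L2_set (\<lambda>k. cmod (\<Sum>n<L. cesaro_adjoint k n *\<^sub>R x n)) {..<m}
      \<le> 2 * L2_set (\<lambda>n. cmod (x n)) {..<L}" for x m L
  proof -
    define v where "v = (\<lambda>n. cmod (x n))"
    define b where "b = (\<lambda>k. \<Sum>n<L. cesaro_adjoint k n * v n)"
    let ?B = "L2_set b {..<L}" and ?V = "L2_set v {..<L}"
    have b_nonneg: "0 \<le> b k" for k
      unfolding b_def v_def cesaro_adjoint_def by (intro sum_nonneg) auto
    have b_zero: "b k = 0" if "L \<le> k" for k
      unfolding b_def cesaro_adjoint_def using that by (intro sum.neutral) auto
    have step: "v k = (real k + 1) * (b k - b (Suc k))" if "k < L" for k
    proof -
      \<comment> \<open>Rows \<open>k\<close> and \<open>Suc k\<close> of the matrix differ only in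
        column \<open>n = k\<close>.\<close>
      have "b k - b (Suc k) = (\<Sum>n<L. if n = k then v n / (real n + 1) else 0)"
        unfolding b_def sum_subtractf[symmetric] cesaro_adjoint_def
        by (intro sum.cong) auto
      thus ?thesis using that by simp
    qed
    have "(\<Sum>k<L. (b k)\<^sup>2 - 2 * (b k * v k))
        \<le> (\<Sum>k<L. real (Suc k) * (b (Suc k))\<^sup>2 - real k * (b k)\<^sup>2)"
    proof (rule sum_mono)
      fix k assume "k \<in> {..<L}"
      \<comment> \<open>After substituting \<open>step\<close>, this square is exactly the
        difference of the two sides.\<close>
      have "0 \<le> (real k + 1) * (b k - b (Suc k))\<^sup>2" by simp
      thus "(b k)\<^sup>2 - 2 * (b k * v k) \<le> real (Suc k) * (b (Suc k))\<^sup>2 - real k * (b k)\<^sup>2"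
        using \<open>k \<in> {..<L}\<close> by (simp add: step power2_eq_square algebra_simps)
    qed
    also have "\<dots> = 0"
      \<comment> \<open>The lower boundary term has the factor \<open>k = 0\<close>, the upper one
        has \<open>b L = 0\<close>.\<close>
      by (subst sum_lessThan_telescope) (simp add: b_zero)
    finally have "(\<Sum>k<L. (b k)\<^sup>2) \<le> 2 * (\<Sum>k<L. b k * v k)"
      by (simp add: sum_subtractf sum_distrib_left)
    also have "\<dots> \<le> 2 * (?B * ?V)"
      using L2_set_mult_ineq[of b v "{..<L}"] b_nonneg by (simp add: v_def)
    finally have "?B * ?B \<le> (2 * ?V) * ?B"
      by (simp add: L2_set_def sum_nonneg mult_ac)
    hence "?B \<le> 2 * ?V"
      by (rule le_of_mult_self_le[OF _ L2_set_nonneg]) (simp add: L2_set_nonneg)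
    moreover have "L2_set (\<lambda>k. cmod (\<Sum>n<L. cesaro_adjoint k n *\<^sub>R x n)) {..<m} \<le> L2_set b {..<m}"
    proof (rule L2_set_mono)
      fix k
      show "cmod (\<Sum>n<L. cesaro_adjoint k n *\<^sub>R x n) \<le> b k"
        unfolding b_def v_def by (rule sum_norm_le) (simp add: cesaro_adjoint_def)
    qed auto
    moreover have "L2_set b {..<m} \<le> ?B"
    proof -
      have "(\<Sum>k<m. (b k)\<^sup>2) \<le> (\<Sum>k<max m L. (b k)\<^sup>2)"
        by (rule sum_mono2) auto
      also have "\<dots> = (\<Sum>k<L. (b k)\<^sup>2)"
        by (rule sum.mono_neutral_right) (auto simp: b_zero)
      finally show ?thesis by (simp add: L2_set_def)
    qed
    ultimately show ?thesis by (simp add: v_def)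
  qed
  thus ?thesis by (simp add: kernel_bound_def)
qed

section \<open>Bernstein matrices and the Schur test\<close>

lemma Bernstein_eq_0: "n < k \<Longrightarrow> Bernstein n k s = 0"
  by (simp add: Bernstein_def)

text \<open>Pascal's rule; in terms of binomial probabilities, conditioning on one trial with
  success probability \<open>s\<close>.\<close>

lemma Bernstein_Suc_Suc:
  "Bernstein (Suc n) (Suc k) s = s * Bernstein n k s + (1 - s) * Bernstein n (Suc k) s"
proof (cases "Suc k \<le> n")
  case True
  hence "n - k = Suc (n - Suc k)" by simp
  thus ?thesis by (simp add: Bernstein_def algebra_simps)
next
  case False
  thus ?thesis by (auto simp: Bernstein_def not_le less_Suc_eq_le binomial_eq_0)
qed

text \<open>The full series is a negative binomial series with sum 1/s. The recursion bounds each
  longer partial sum by s times a row sum for \<open>k\<close> plus (1 - s) times a shorter one for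
  \<open>Suc k\<close>, and 1/s is preserved by this convex combination.\<close>

lemma sum_Bernstein_row_le:
  assumes "0 < s" "s \<le> 1"
  shows "(\<Sum>n<L. Bernstein n k s) \<le> 1 / s"
proof (induction k arbitrary: L)
  case 0
  show ?case
  proof (induction L)
    case (Suc L)
    have "(\<Sum>n<Suc L. Bernstein n 0 s) = 1 + (1 - s) * (\<Sum>n<L. Bernstein n 0 s)"
      unfolding sum.lessThan_Suc_shift by (simp add: Bernstein_def sum_distrib_left)
    also have "\<dots> \<le> 1 + (1 - s) * (1 / s)"
      using assms by (intro add_mono mult_left_mono Suc.IH) auto
    also have "\<dots> = 1 / s" using assms by (simp add: field_simps)
    finally show ?case .
  qed (use assms in simp)
next
  case (Suc k)
  show ?case
  proof (induction L)
    case (Suc L)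
    have "(\<Sum>n<Suc L. Bernstein n (Suc k) s)
        = s * (\<Sum>n<L. Bernstein n k s) + (1 - s) * (\<Sum>n<L. Bernstein n (Suc k) s)"
      unfolding sum.lessThan_Suc_shift
      by (simp add: Bernstein_eq_0 Bernstein_Suc_Suc sum.distrib sum_distrib_left)
    also have "\<dots> \<le> s * (1 / s) + (1 - s) * (1 / s)"
      using assms by (intro add_mono mult_left_mono Suc.IH \<open>\<And>L. (\<Sum>n<L. Bernstein n k s) \<le> 1 / s\<close>) auto
    also have "\<dots> = 1 / s" using assms by (simp add: field_simps)
    finally show ?case .
  qed (use assms in simp)
qed

lemma sum_Bernstein_column_le:
  assumes "0 \<le> s" "s \<le> 1"
  shows "(\<Sum>k<m. Bernstein n k s) \<le> 1"
proof -
  have "(\<Sum>k<m. Bernstein n k s) \<le> (\<Sum>k\<le>max m n. Bernstein n k s)"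
    by (rule sum_mono2) (auto simp: Bernstein_nonneg assms)
  also have "\<dots> = (\<Sum>k\<le>n. Bernstein n k s)"
    by (rule sum.mono_neutral_right) (auto simp: Bernstein_eq_0)
  finally show ?thesis by simp
qed

text \<open>Row sums are at most 1/s and column sums at most 1, and the Schur test gives the square
  root of their product.\<close>

lemma kernel_bound_Bernstein:
  assumes s: "0 < s" "s \<le> 1"
  shows "kernel_bound (\<lambda>k n. Bernstein n k s) (1 / sqrt s)"
proof -
  have "L2_set (\<lambda>k. cmod (\<Sum>n<L. Bernstein n k s *\<^sub>R x n)) {..<m}
      \<le> 1 / sqrt s * L2_set (\<lambda>n. cmod (x n)) {..<L}" for x m L
  proof -
    let ?B = "\<lambda>k n. Bernstein n k s"
    have nonneg: "0 \<le> ?B k n" for k n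
      using s by (intro Bernstein_nonneg) auto
    have row: "(cmod (\<Sum>n<L. ?B k n *\<^sub>R x n))\<^sup>2 \<le> 1 / s * (\<Sum>n<L. ?B k n * (cmod (x n))\<^sup>2)" for k
    proof -
      \<comment> \<open>Each weight is split into two square roots: one yields the row sum by
        Cauchy-Schwarz, the other keeps the weight on \<open>x\<close>, to be summed over
        columns.\<close>
      have "cmod (\<Sum>n<L. ?B k n *\<^sub>R x n) \<le> (\<Sum>n<L. \<bar>sqrt (?B k n)\<bar> * \<bar>sqrt (?B k n) * cmod (x n)\<bar>)"
        by (rule sum_norm_le) (simp add: nonneg abs_mult mult.assoc [symmetric] del: mult.assoc)
      also have "\<dots> \<le> sqrt (\<Sum>n<L. ?B k n) * sqrt (\<Sum>n<L. ?B k n * (cmod (x n))\<^sup>2)"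
        using L2_set_mult_ineq[of "\<lambda>n. sqrt (?B k n)" "\<lambda>n. sqrt (?B k n) * cmod (x n)" "{..<L}"]
        by (simp add: L2_set_def nonneg power_mult_distrib)
      finally have "(cmod (\<Sum>n<L. ?B k n *\<^sub>R x n))\<^sup>2
          \<le> (sqrt (\<Sum>n<L. ?B k n) * sqrt (\<Sum>n<L. ?B k n * (cmod (x n))\<^sup>2))\<^sup>2"
        by (rule power_mono) simp
      also have "\<dots> = (\<Sum>n<L. ?B k n) * (\<Sum>n<L. ?B k n * (cmod (x n))\<^sup>2)"
        by (simp add: power_mult_distrib sum_nonneg nonneg)
      also have "\<dots> \<le> 1 / s * (\<Sum>n<L. ?B k n * (cmod (x n))\<^sup>2)"
        using s by (intro mult_right_mono sum_Bernstein_row_le sum_nonneg) (auto simp: nonneg)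
      finally show ?thesis .
    qed
    have "(\<Sum>k<m. (cmod (\<Sum>n<L. ?B k n *\<^sub>R x n))\<^sup>2)
        \<le> (\<Sum>k<m. 1 / s * (\<Sum>n<L. ?B k n * (cmod (x n))\<^sup>2))"
      by (intro sum_mono row)
    also have "\<dots> = 1 / s * (\<Sum>k<m. \<Sum>n<L. ?B k n * (cmod (x n))\<^sup>2)"
      by (rule sum_distrib_left[symmetric])
    also have "(\<Sum>k<m. \<Sum>n<L. ?B k n * (cmod (x n))\<^sup>2) = (\<Sum>n<L. (\<Sum>k<m. ?B k n) * (cmod (x n))\<^sup>2)"
      by (subst sum.swap) (simp add: sum_distrib_right)
    also have "1 / s * \<dots> \<le> 1 / s * (\<Sum>n<L. 1 * (cmod (x n))\<^sup>2)"
      using s by (intro mult_left_mono sum_mono mult_right_mono sum_Bernstein_column_le) auto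
    finally have "sqrt (\<Sum>k<m. (cmod (\<Sum>n<L. ?B k n *\<^sub>R x n))\<^sup>2) \<le> sqrt (1 / s * (\<Sum>n<L. (cmod (x n))\<^sup>2))"
      by simp
    thus ?thesis
      by (simp add: L2_set_def real_sqrt_mult real_sqrt_divide)
  qed
  thus ?thesis using s by (simp add: kernel_bound_def)
qed

section \<open>Riemann sums of the Bernstein matrices\<close>

text \<open>Each summand is compared with the increment of an antiderivative over its subinterval;
  uniform continuity makes the error less than \<open>e\<close> times the mesh, and the increments
  telescope to the integral.\<close>

lemma riemann_sum_tendsto_integral:
  fixes f :: "real \<Rightarrow> real"
  assumes f: "continuous_on {0..1} f"
  shows "(\<lambda>N. (\<Sum>j<Suc N. f (real (Suc j) / real (Suc N))) / real (Suc N)) \<longlonglongrightarrow> integral {0..1} f"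
proof (rule LIMSEQ_I)
  fix e :: real assume "0 < e"
  have "uniformly_continuous_on {0..1} f"
    by (rule compact_uniformly_continuous[OF f]) auto
  then obtain d where d: "0 < d"
    "\<And>x y. x \<in> {0..1} \<Longrightarrow> y \<in> {0..1} \<Longrightarrow> \<bar>y - x\<bar> < d \<Longrightarrow> \<bar>f y - f x\<bar> < e"
    using \<open>0 < e\<close> unfolding uniformly_continuous_on_def dist_real_def by metis
  obtain N0 where N0: "inverse (real (Suc N0)) < d"
    using reals_Archimedean[OF d(1)] by blast
  define F where "F = (\<lambda>x. integral {0..x} f)"
  have F: "(F has_real_derivative f x) (at x within {0..1})" if "x \<in> {0..1}" for x
    unfolding F_def by (rule integral_has_real_derivative[OF f that])
  have "norm ((\<Sum>j<Suc N. f (real (Suc j) / real (Suc N))) / real (Suc N) - integral {0..1} f) < e"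
    if "N \<ge> N0" for N
  proof -
    define h where "h = 1 / real (Suc N)"
    have h: "0 < h" "h < d" "h * real (Suc N) = 1"
      using N0 that le_imp_inverse_le[of "real (Suc N0)" "real (Suc N)"]
      by (auto simp: h_def inverse_eq_divide)
    have part: "\<bar>f (real (Suc j) * h) * h - (F (real (Suc j) * h) - F (real j * h))\<bar> < e * h"
      if "j < Suc N" for j
    proof -
      let ?a = "real j * h" and ?b = "real (Suc j) * h"
      have "?b \<le> real (Suc N) * h"
        using that h by (intro mult_right_mono) auto
      hence ab: "0 \<le> ?a" "?a < ?b" "?b \<le> 1"
        using h(1) unfolding mult.commute[of _ h] h(3) by auto
      \<comment> \<open>The increment is \<open>h * f x\<close> with \<open>x\<close> inside the
        subinterval, so only \<open>f ?b - f x\<close> remains to be estimated, at points closer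
        than \<open>h < d\<close>.\<close>
      have "\<exists>x\<in>{?a<..<?b}. F ?b - F ?a = (\<lambda>u. u * f x) (?b - ?a)"
      proof (rule mvt_simple[OF ab(2)])
        fix x assume "?a \<le> x" "x \<le> ?b"
        hence "(F has_real_derivative f x) (at x within {?a..?b})"
          using ab by (intro DERIV_subset[OF F]) auto
        thus "(F has_derivative (\<lambda>u. u * f x)) (at x within {?a..?b})"
          by (simp add: has_field_derivative_def mult_commute_abs)
      qed
      moreover have "?b - ?a = h" by (simp add: algebra_simps)
      ultimately obtain x where x: "x \<in> {?a<..<?b}" "F ?b - F ?a = h * f x"
        by metis
      have "\<bar>f ?b - f x\<bar> < e"
      proof (rule d(2))
        show "x \<in> {0..1}" "?b \<in> {0..1}" using x(1) ab by auto
        show "\<bar>?b - x\<bar> < d" using x(1) h by (auto simp: algebra_simps)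
      qed
      hence "\<bar>f ?b - f x\<bar> * h < e * h" using h by simp
      moreover have "f ?b * h - (F ?b - F ?a) = (f ?b - f x) * h"
        unfolding x(2) by (simp add: algebra_simps)
      ultimately show ?thesis using h(1) by (simp only: abs_mult abs_of_pos)
    qed
    have "integral {0..1} f = (\<Sum>j<Suc N. F (real (Suc j) * h) - F (real j * h))"
      by (subst sum_lessThan_telescope[of "\<lambda>j. F (real j * h)"])
         (use h in \<open>simp add: F_def mult.commute\<close>)
    moreover have "(\<Sum>j<Suc N. f (real (Suc j) / real (Suc N))) / real (Suc N)
        = (\<Sum>j<Suc N. f (real (Suc j) * h) * h)"
      by (simp add: h_def sum_divide_distrib del: sum.lessThan_Suc)
    ultimately have "norm ((\<Sum>j<Suc N. f (real (Suc j) / real (Suc N))) / real (Suc N)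
        - integral {0..1} f)
        = \<bar>\<Sum>j<Suc N. f (real (Suc j) * h) * h - (F (real (Suc j) * h) - F (real j * h))\<bar>"
      by (simp only: sum_subtractf real_norm_def)
    also have "\<dots> \<le> (\<Sum>j<Suc N. \<bar>f (real (Suc j) * h) * h - (F (real (Suc j) * h) - F (real j * h))\<bar>)"
      by (rule sum_abs)
    also have "\<dots> < (\<Sum>j<Suc N. e * h)"
      by (rule sum_strict_mono) (use part in auto)
    also have "\<dots> = e" using h(3) by (simp add: mult.commute mult.left_commute)
    finally show ?thesis .
  qed
  thus "\<exists>N0. \<forall>N\<ge>N0. norm ((\<Sum>j<Suc N. f (real (Suc j) / real (Suc N))) / real (Suc N)
      - integral {0..1} f) < e" by blast
qed

text \<open>The integral is a binomial coefficient times a Beta value at integers, and the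
  factorials cancel to leave 1/(n+1).\<close>

lemma integral_Bernstein:
  assumes "k \<le> n"
  shows "integral {0..1} (Bernstein n k) = 1 / (real n + 1)"
proof -
  have "((\<lambda>t. t powr (real (Suc k) - 1) * (1 - t) powr (real (Suc (n - k)) - 1))
      has_integral Beta (real (Suc k)) (real (Suc (n - k)))) {0..1}"
    by (rule has_integral_Beta_real) auto
  \<comment> \<open>The endpoints are removed because \<open>0 powr 0 = 0\<close> while
    \<open>0 ^ 0 = 1\<close>.\<close>
  hence "((\<lambda>t. t ^ k * (1 - t) ^ (n - k))
      has_integral Beta (real (Suc k)) (real (Suc (n - k)))) {0..1}"
    by (rule has_integral_spike_finite[rotated 2, of _ _ _ "{0, 1}"]) (auto simp: powr_realpow)
  from has_integral_mult_right[OF this, of "real (n choose k)"]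
  have "(Bernstein n k has_integral
      real (n choose k) * Beta (real (Suc k)) (real (Suc (n - k)))) {0..1}"
    by (simp add: Bernstein_def[abs_def] mult.assoc)
  moreover have "Beta (real (Suc k)) (real (Suc (n - k))) = fact k * fact (n - k) / fact (Suc n)"
    using Gamma_fact[of k, where 'a = real] Gamma_fact[of "n - k", where 'a = real]
      Gamma_fact[of "Suc n", where 'a = real] assms
    by (simp add: Beta_def add_ac of_nat_diff)
  moreover have "real (n choose k) * (fact k * fact (n - k) / fact (Suc n)) = 1 / (real n + 1)"
  proof -
    have "real (n choose k) * (fact k * fact (n - k)) = fact n"
      using binomial_fact_lemma[OF assms, THEN arg_cong[of _ _ real]] by (simp add: mult_ac)
    thus ?thesis unfolding times_divide_eq_right by (simp add: add.commute)
  qed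
  ultimately show ?thesis by (metis integral_unique)
qed

text \<open>Each term is at most twice the increment of the square root, and these increments
  telescope.\<close>

lemma sum_inverse_sqrt_le: "(\<Sum>j<N. 1 / sqrt (real (Suc j))) \<le> 2 * sqrt (real N)"
proof (induction N)
  case (Suc N)
  have "(sqrt (real (Suc N)) - sqrt (real N)) * (sqrt (real (Suc N)) + sqrt (real N)) = 1"
    by (simp add: algebra_simps)
  moreover have "(sqrt (real (Suc N)) - sqrt (real N)) * (sqrt (real (Suc N)) + sqrt (real N))
      \<le> (sqrt (real (Suc N)) - sqrt (real N)) * (2 * sqrt (real (Suc N)))"
    by (intro mult_left_mono) auto
  ultimately have "1 / sqrt (real (Suc N)) \<le> 2 * (sqrt (real (Suc N)) - sqrt (real N))"
    by (simp add: field_simps)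
  thus ?case using Suc.IH by simp
qed simp

text \<open>Right endpoints are used: the node 0 would correspond to infinite t, and the bound
  s^(-1/2) is singular there.\<close>

definition riemann_kernel :: "nat \<Rightarrow> nat \<Rightarrow> nat \<Rightarrow> real" where
  "riemann_kernel N k n
     = (\<Sum>j<Suc N. 1 / real (Suc N) * Bernstein n k (real (Suc j) / real (Suc N)))"

text \<open>The bounds for single nodes blow up near 0, but their average stays below 2, the
  integral of s^(-1/2) over the unit interval.\<close>

lemma kernel_bound_riemann: "kernel_bound (riemann_kernel N) 2"
proof -
  let ?M = "real (Suc N)"
  have "kernel_bound (\<lambda>k n. 1 / ?M * Bernstein n k (real (Suc j) / ?M))
      (\<bar>1 / ?M\<bar> * (1 / sqrt (real (Suc j) / ?M)))" if "j < Suc N" for j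
    using that by (intro kernel_bound_scale kernel_bound_Bernstein) auto
  hence "kernel_bound (riemann_kernel N) (\<Sum>j<Suc N. \<bar>1 / ?M\<bar> * (1 / sqrt (real (Suc j) / ?M)))"
    unfolding riemann_kernel_def[abs_def] by (intro kernel_bound_sum) auto
  moreover have "(\<Sum>j<Suc N. \<bar>1 / ?M\<bar> * (1 / sqrt (real (Suc j) / ?M))) \<le> 2"
  proof -
    have "(\<Sum>j<Suc N. \<bar>1 / ?M\<bar> * (1 / sqrt (real (Suc j) / ?M)))
        = sqrt ?M / ?M * (\<Sum>j<Suc N. 1 / sqrt (real (Suc j)))"
      unfolding sum_distrib_left by (intro sum.cong) (auto simp: real_sqrt_divide)
    also have "\<dots> \<le> sqrt ?M / ?M * (2 * sqrt ?M)"
      by (intro mult_left_mono sum_inverse_sqrt_le) auto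
    also have "\<dots> = 2" by (simp add: field_simps)
    finally show ?thesis .
  qed
  ultimately show ?thesis by (rule kernel_bound_mono)
qed

lemma riemann_kernel_tendsto: "(\<lambda>N. riemann_kernel N k n) \<longlonglongrightarrow> cesaro_adjoint k n"
proof (cases "k \<le> n")
  case True
  have "continuous_on {0..1} (Bernstein n k)"
    unfolding Bernstein_def[abs_def] by (intro continuous_intros)
  from riemann_sum_tendsto_integral[OF this] True show ?thesis
    by (simp add: riemann_kernel_def cesaro_adjoint_def integral_Bernstein sum_divide_distrib
        del: of_nat_Suc sum.lessThan_Suc)
next
  case False
  thus ?thesis by (simp add: riemann_kernel_def cesaro_adjoint_def Bernstein_eq_0)
qed

lemma riemann_kernel_op_tendsto:
  assumes "x \<in> ell2"
  shows "(\<lambda>N. ell2_norm (\<lambda>k. kernel_op (riemann_kernel N) x k - kernel_op cesaro_adjoint x k))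
    \<longlonglongrightarrow> 0"
proof -
  let ?E = "\<lambda>N k n. riemann_kernel N k n + (- 1) * cesaro_adjoint k n"
  have "(\<lambda>N. ell2_norm (kernel_op (?E N) x)) \<longlonglongrightarrow> 0"
  \<comment> \<open>The constant is 2 + 2, from the Riemann and Cesaro bounds.\<close>
  proof (rule kernel_op_tendsto_zero[where C = 4])
    show "kernel_bound (?E N) 4" for N
      using kernel_bound_add[OF kernel_bound_riemann
          kernel_bound_scale[OF kernel_bound_cesaro_adjoint, of "- 1"]] by simp
    show "?E N k n = 0" if "n < k" for N k n
      using that by (simp add: riemann_kernel_def cesaro_adjoint_def Bernstein_eq_0)
    show "(\<lambda>N. ?E N k n) \<longlonglongrightarrow> 0" for k n
      using tendsto_diff[OF riemann_kernel_tendsto[of k n] tendsto_const[of "cesaro_adjoint k n"]]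
      by simp
  qed (rule assms)
  moreover have "kernel_op (?E N) x
      = (\<lambda>k. kernel_op (riemann_kernel N) x k - kernel_op cesaro_adjoint x k)" for N
    unfolding kernel_op_def
    by (subst suminf_diff[OF kernel_op_summable[OF kernel_bound_riemann assms]
          kernel_op_summable[OF kernel_bound_cesaro_adjoint assms]])
       (simp add: scaleR_left_diff_distrib)
  ultimately show ?thesis by simp
qed

section \<open>Composition operators in Taylor coefficients\<close>

lemma taylor_coeff_ell2: "f \<in> hardy_space \<Longrightarrow> taylor_coeff f \<in> ell2"
  by (simp add: hardy_space_def ell2_def)

lemma hardy_dist_eq_ell2_norm:
  "f \<in> hardy_space \<Longrightarrow> g \<in> hardy_space \<Longrightarrow>
     hardy_dist f g = ell2_norm (\<lambda>n. taylor_coeff f n - taylor_coeff g n)"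
  by (simp add: hardy_dist_def hardy_norm_def ell2_norm_def taylor_coeff_diff)

lemma taylor_coeff_of_coeffs_ell2: "x \<in> ell2 \<Longrightarrow> taylor_coeff (of_coeffs x) = x"
  using taylor_coeff_of_coeffs by (auto simp: ell2_def)

lemma of_coeffs_ell2_in_hardy_space: "x \<in> ell2 \<Longrightarrow> of_coeffs x \<in> hardy_space"
  using of_coeffs_in_hardy_space by (simp add: ell2_def)

text \<open>The image is a convex combination of z and 1 in which z has positive weight.\<close>

lemma phi_in_ball:
  assumes "0 \<le> t" "z \<in> ball 0 1"
  shows "phi t z \<in> ball 0 1"
proof -
  let ?s = "exp (- t)"
  have "cmod (phi t z) = cmod (of_real ?s * z + of_real (1 - ?s))"
    by (simp add: phi_def add_diff_eq)
  also have "\<dots> \<le> ?s * cmod z + (1 - ?s)"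
    using norm_triangle_ineq[of "of_real ?s * z" "of_real (1 - ?s)"] assms(1)
    by (simp add: norm_mult del: of_real_diff of_real_1)
  also have "\<dots> < ?s * 1 + (1 - ?s)"
    using assms(2) by (intro add_strict_right_mono mult_strict_left_mono) auto
  finally show ?thesis by simp
qed

text \<open>
  The transpose of the Bernstein kernel maps \<open>(z\<^sup>k)\<^sub>k\<close> to the powers of
  \<open>phi t z\<close>, so the interchange of sums is an instance of the pairing lemma.
\<close>

lemma taylor_coeff_comp_op:
  assumes t: "0 \<le> t" and g: "g \<in> hardy_space"
  shows "taylor_coeff (comp_op (phi t) g)
    = kernel_op (\<lambda>k n. Bernstein n k (exp (- t))) (taylor_coeff g)"
proof
  fix k
  let ?K = "\<lambda>k n. Bernstein n k (exp (- t))"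
  have K: "kernel_bound ?K (1 / sqrt (exp (- t)))"
    using t by (intro kernel_bound_Bernstein) auto
  note x = taylor_coeff_ell2[OF g]
  show "taylor_coeff (comp_op (phi t) g) k = kernel_op ?K (taylor_coeff g) k"
  proof (rule taylor_coeff_unique)
    fix z :: complex assume z: "z \<in> ball 0 1"
    hence u: "(\<lambda>k. z ^ k) \<in> ell2" by (intro ell2_powers) auto
    have pow: "kernel_op (\<lambda>n k. ?K k n) (\<lambda>k. z ^ k) n = phi t z ^ n" for n
    proof -
      have "kernel_op (\<lambda>n k. ?K k n) (\<lambda>k. z ^ k) n = (\<Sum>k\<le>n. ?K k n *\<^sub>R z ^ k)"
        unfolding kernel_op_def by (rule suminf_finite) (auto simp: Bernstein_eq_0)
      \<comment> \<open>This is the binomial theorem: the powers of \<open>exp (- t)\<close> and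
        \<open>1 - exp (- t)\<close> form the Bernstein weights.\<close>
      also have "\<dots> = (of_real (exp (- t)) * z + of_real (1 - exp (- t))) ^ n"
        unfolding binomial_ring
        by (intro sum.cong)
           (auto simp: Bernstein_def scaleR_conv_of_real power_mult_distrib mult_ac)
      finally show ?thesis by (simp add: phi_def add_diff_eq)
    qed
    have "(\<lambda>n. taylor_coeff g n * phi t z ^ n) sums g (phi t z)"
      by (rule taylor_coeff_sums[OF g phi_in_ball[OF t z]])
    moreover have "(\<lambda>n. taylor_coeff g n * phi t z ^ n) sums
        (\<Sum>k. z ^ k * kernel_op ?K (taylor_coeff g) k)"
      using kernel_op_pairing[OF K u x] by (simp add: pow mult.commute)
    ultimately have "(\<Sum>k. z ^ k * kernel_op ?K (taylor_coeff g) k) = comp_op (phi t) g z"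
      using z sums_unique2 by (fastforce simp: comp_op_def)
    moreover have "summable (\<lambda>k. z ^ k * kernel_op ?K (taylor_coeff g) k)"
      by (rule ell2_Cauchy_Schwarz(1)[OF u kernel_op_ell2[OF K x]])
    ultimately show "(\<lambda>k. kernel_op ?K (taylor_coeff g) k * z ^ k) sums comp_op (phi t) g z"
      using summable_sums by (fastforce simp: mult.commute)
  qed
qed

section \<open>The adjoint of the Rhaly operator\<close>

lemma kernel_op_cnj:
  assumes "kernel_bound K C" "x \<in> ell2"
  shows "cnj (kernel_op K x k) = kernel_op K (\<lambda>n. cnj (x n)) k"
proof -
  have "(\<lambda>n. cnj (K k n *\<^sub>R x n)) sums cnj (kernel_op K x k)"
    unfolding sums_cnj kernel_op_def by (rule summable_sums[OF kernel_op_summable[OF assms]])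
  thus ?thesis by (simp add: kernel_op_def sums_iff)
qed

lemma hardy_adjoint_eqI:
  assumes "h \<in> hardy_space"
    and "\<And>f. f \<in> hardy_space \<Longrightarrow> hardy_inner (T f) g = hardy_inner f h"
  shows "hardy_adjoint T g = h"
  unfolding hardy_adjoint_def
proof (rule the_equality)
  fix h'
  assume "h' \<in> hardy_space \<and> (\<forall>f\<in>hardy_space. hardy_inner (T f) g = hardy_inner f h')"
  with assms show "h' = h" by (intro hardy_adjoint_unique) auto
qed (use assms in auto)

text \<open>The Rhaly operator is Cesaro averaging followed by the diagonal (n+1) a_n. Adjoints
  reverse the order and conjugate the diagonal, so the bounded diagonal acts first and the adjoint
  Cesaro matrix second.\<close>

lemma hardy_adjoint_rhaly_op:
  assumes a: "bounded (range (\<lambda>n. of_nat (n + 1) * a n))" and f: "f \<in> hardy_space"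
  shows "hardy_adjoint (rhaly_op a) f
    = of_coeffs (kernel_op cesaro_adjoint (\<lambda>n. of_nat (n + 1) * cnj (a n) * taylor_coeff f n))"
proof (rule hardy_adjoint_eqI)
  let ?A = cesaro_adjoint
  define x where "x = (\<lambda>n. of_nat (n + 1) * cnj (a n) * taylor_coeff f n)"
  note A = kernel_bound_cesaro_adjoint
  obtain B where B: "\<And>n. cmod (of_nat (n + 1) * a n) \<le> B"
    using a by (auto simp: bounded_iff)
  have x: "x \<in> ell2"
    unfolding x_def using B by (intro ell2_bounded_mult[OF taylor_coeff_ell2[OF f]]) (simp add: norm_mult)
  note Ax = kernel_op_ell2[OF A x]
  show "of_coeffs (kernel_op ?A x) \<in> hardy_space"
    by (rule of_coeffs_ell2_in_hardy_space[OF Ax])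
  fix g assume g: "g \<in> hardy_space"
  let ?u = "taylor_coeff g"
  have u: "?u \<in> ell2" by (rule taylor_coeff_ell2[OF g])
  have rhaly: "a n * (\<Sum>k\<le>n. ?u k) = of_nat (n + 1) * a n * kernel_op (\<lambda>n k. ?A k n) ?u n" for n
  proof -
    have "kernel_op (\<lambda>n k. ?A k n) ?u n = (\<Sum>k\<le>n. ?A k n *\<^sub>R ?u k)"
      unfolding kernel_op_def by (rule suminf_finite) (auto simp: cesaro_adjoint_def)
    also have "\<dots> = (1 / (real n + 1)) *\<^sub>R (\<Sum>k\<le>n. ?u k)"
      unfolding scaleR_right.sum by (intro sum.cong) (auto simp: cesaro_adjoint_def)
    finally show ?thesis
      by (simp add: scaleR_conv_of_real field_simps flip: of_nat_Suc)
  qed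
  have "(\<lambda>n. a n * (\<Sum>k\<le>n. ?u k)) \<in> ell2"
    unfolding rhaly
    by (rule ell2_bounded_mult[OF kernel_op_ell2[OF kernel_bound_transpose[OF A] u] B])
  hence "hardy_inner (rhaly_op a g) f = (\<Sum>n. a n * (\<Sum>k\<le>n. ?u k) * cnj (taylor_coeff f n))"
    by (simp add: hardy_inner_def rhaly_op_def taylor_coeff_of_coeffs_ell2)
  also have "\<dots> = (\<Sum>n. kernel_op (\<lambda>n k. ?A k n) ?u n * cnj (x n))"
    unfolding rhaly x_def by (simp add: mult_ac)
  \<comment> \<open>The pairing is bilinear, so the conjugate sits on \<open>x\<close> first; it
    moves outside because the matrix is real.\<close>
  also have "\<dots> = (\<Sum>k. ?u k * kernel_op ?A (\<lambda>n. cnj (x n)) k)"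
    using kernel_op_pairing[OF A u, of "\<lambda>n. cnj (x n)"] x by (simp add: sums_iff)
  also have "\<dots> = hardy_inner g (of_coeffs (kernel_op ?A x))"
    by (simp add: hardy_inner_def taylor_coeff_of_coeffs_ell2[OF Ax] kernel_op_cnj[OF A x])
  finally show "hardy_inner (rhaly_op a g) f = hardy_inner g (of_coeffs (kernel_op ?A x))" .
qed

section \<open>Approximation inside an invariant subspace\<close>

lemma taylor_coeff_linear_combination:
  assumes "\<And>j. j \<in> J \<Longrightarrow> f j \<in> hardy_space"
  shows "taylor_coeff (\<Sum>j\<in>J. (\<lambda>z. c j * f j z)) n = (\<Sum>j\<in>J. c j * taylor_coeff (f j) n)"
proof (rule taylor_coeff_unique)
  fix z :: complex assume "z \<in> ball 0 1"
  hence "(\<lambda>n. \<Sum>j\<in>J. c j * (taylor_coeff (f j) n * z ^ n)) sums (\<Sum>j\<in>J. c j * f j z)"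
    using assms by (intro sums_sum sums_mult taylor_coeff_sums) auto
  moreover have "(\<Sum>j\<in>J. (\<lambda>z. c j * f j z)) z = (\<Sum>j\<in>J. c j * f j z)"
    by (induction J rule: infinite_finite_induct) auto
  ultimately show "(\<lambda>n. (\<Sum>j\<in>J. c j * taylor_coeff (f j) n) * z ^ n) sums
      (\<Sum>j\<in>J. (\<lambda>z. c j * f j z)) z"
    by (simp add: sum_distrib_right mult.assoc)
qed

theorem theorem3p2:
  fixes a :: "nat \<Rightarrow> complex" and M :: "(complex \<Rightarrow> complex) set"
  assumes "bounded (range (\<lambda>n. of_nat (n + 1) * a n))"
    and "M \<subseteq> hardy_space" and "cfun.subspace M" and "closedin hardy.mtopology M"
    and "\<And>t. t \<ge> 0 \<Longrightarrow>
           (comp_op (phi t) \<circ> diag_op (\<lambda>n. of_nat (n + 1) * cnj (a n))) ` M \<subseteq> M"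
  shows "hardy_adjoint (rhaly_op a) ` M \<subseteq> M"
proof (rule image_subsetI)
  fix f assume "f \<in> M"
  hence f: "f \<in> hardy_space" using assms(2) by blast
  define x where "x = (\<lambda>n. of_nat (n + 1) * cnj (a n) * taylor_coeff f n)"
  define g where "g = of_coeffs x"
  define h where "h = of_coeffs (kernel_op cesaro_adjoint x)"
  obtain B where B: "\<And>n. cmod (of_nat (n + 1) * a n) \<le> B"
    using assms(1) by (auto simp: bounded_iff)
  have x: "x \<in> ell2"
    unfolding x_def using B by (intro ell2_bounded_mult[OF taylor_coeff_ell2[OF f]]) (simp add: norm_mult)
  have g: "g \<in> hardy_space" "taylor_coeff g = x"
    unfolding g_def using x of_coeffs_ell2_in_hardy_space taylor_coeff_of_coeffs_ell2 by auto
  note Ax = kernel_op_ell2[OF kernel_bound_cesaro_adjoint x]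
  have h: "h \<in> hardy_space" "taylor_coeff h = kernel_op cesaro_adjoint x"
    unfolding h_def using Ax of_coeffs_ell2_in_hardy_space taylor_coeff_of_coeffs_ell2 by auto
  \<comment> \<open>Here \<open>g\<close> is the diagonal operator applied to \<open>f\<close>, so
    the invariance hypothesis applies to every \<open>t\<close>.\<close>
  have comp_M: "comp_op (phi t) g \<in> M" if "0 \<le> t" for t
    using assms(5)[OF that] \<open>f \<in> M\<close> by (auto simp: g_def x_def diag_op_def)
  \<comment> \<open>The node \<open>s N j\<close> belongs to \<open>t = - ln (s N j)\<close>, for
    which \<open>exp (- t)\<close> is the node. Under this substitution the weight e^(-t) dt becomes
    ds, hence the equal coefficients in \<open>F\<close>.\<close>
  define s where "s = (\<lambda>N j. real (Suc j) / real (Suc N))"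
  define F where "F = (\<lambda>N. \<Sum>j<Suc N. (\<lambda>z. of_real (1 / real (Suc N)) * comp_op (phi (- ln (s N j))) g z))"
  have s: "0 < s N j" "0 \<le> - ln (s N j)" if "j < Suc N" for N j
    using that by (auto simp: s_def)
  have F_M: "F N \<in> M" for N
    unfolding F_def by (intro cfun.subspace_sum cfun.subspace_scale assms(3) comp_M s) auto
  have coeff_F: "taylor_coeff (F N) = kernel_op (riemann_kernel N) x" for N
  proof
    fix k
    have "taylor_coeff (F N) k = (\<Sum>j<Suc N. of_real (1 / real (Suc N)) *
        taylor_coeff (comp_op (phi (- ln (s N j))) g) k)"
      unfolding F_def using comp_M s assms(2) by (intro taylor_coeff_linear_combination) auto
    also have "\<dots> = (\<Sum>j<Suc N. \<Sum>n. (1 / real (Suc N) * Bernstein n k (s N j)) *\<^sub>R x n)"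
    proof (intro sum.cong refl)
      fix j assume "j \<in> {..<Suc N}"
      hence s': "0 < s N j" "0 \<le> - ln (s N j)" "s N j \<le> 1" using s[of j N] by (auto simp: s_def)
      have "(\<lambda>n. of_real (1 / real (Suc N)) * (Bernstein n k (s N j) *\<^sub>R x n)) sums
          (of_real (1 / real (Suc N)) * kernel_op (\<lambda>k n. Bernstein n k (s N j)) x k)"
        unfolding kernel_op_def
        by (intro sums_mult summable_sums kernel_op_summable[OF kernel_bound_Bernstein[OF s'(1,3)] x])
      thus "of_real (1 / real (Suc N)) * taylor_coeff (comp_op (phi (- ln (s N j))) g) k
          = (\<Sum>n. (1 / real (Suc N) * Bernstein n k (s N j)) *\<^sub>R x n)"
        unfolding taylor_coeff_comp_op[OF s'(2) g(1)] g(2)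
        using s'(1) by (simp add: sums_iff scaleR_conv_of_real mult.assoc)
    qed
    \<comment> \<open>Exchanging the finite sum with the convergent series assembles the combination
      of composition operators into the single matrix \<open>riemann_kernel N\<close>.\<close>
    also have "\<dots> = (\<Sum>n. \<Sum>j<Suc N. (1 / real (Suc N) * Bernstein n k (s N j)) *\<^sub>R x n)"
    proof (rule suminf_sum[symmetric])
      fix j assume "j \<in> {..<Suc N}"
      hence "0 < s N j" "s N j \<le> 1" by (auto simp: s_def)
      from kernel_op_summable[OF kernel_bound_scale[OF kernel_bound_Bernstein[OF this]] x]
      show "summable (\<lambda>n. (1 / real (Suc N) * Bernstein n k (s N j)) *\<^sub>R x n)" .
    qed
    also have "\<dots> = kernel_op (riemann_kernel N) x k"
      by (simp only: kernel_op_def riemann_kernel_def s_def scaleR_left.sum)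
    finally show "taylor_coeff (F N) k = kernel_op (riemann_kernel N) x k" .
  qed
  have "(\<lambda>N. hardy_dist (F N) h) \<longlonglongrightarrow> 0"
    using riemann_kernel_op_tendsto[OF x] F_M assms(2) h
    by (simp add: hardy_dist_eq_ell2_norm coeff_F subset_iff)
  hence "limitin hardy.mtopology F h sequentially"
    unfolding hardy.limitin_metric using F_M assms(2) h(1)
    by (auto simp: subset_iff intro: order_tendstoD(2))
  hence "h \<in> M"
    using assms(4) F_M unfolding hardy.metric_closedin_iff_sequentially_closed by blast
  thus "hardy_adjoint (rhaly_op a) f \<in> M"
    by (simp add: hardy_adjoint_rhaly_op[OF assms(1) f] h_def x_def)
qed

end
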